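(* Let $n\geq 1$. For any $\mu,\mu'\in\mathsf{BP}_n$, we have $\mu\equiv_0\mu'$ if and only if for every automata network $f:X\to X$ of size $n$ (that is, for every choice of finite non-empty alphabets $X_0,\dots,X_{n-1}$, with $X=\prod_{i\in\llbracket n\rrbracket}X_i$, and every function $f:X\to X$), $f_{\{\mu\}}=f_{\{\mu'\}}$.
   Context: Notation: $\llbracket n\rrbracket=\{0,\dots,n-1\}$. A partitioned order of $\llbracket n\rrbracket$ is an (unordered) set $\{S_k\}_{k\in\llbracket s\rrbracket}$ of $s$ sequences $S_k=(i^k_0,\dots,i^k_{n_k-1})$ with $n_k>0$, each consisting of pairwise distinct elements of $\llbracket n\rrbracket$, the sequences being pairwise disjoint (as sets of entries) with union $\llbracket n\rrbracket$. $\mathsf{BP}_n$ is the set of all partitioned orders of $\llbracket n\rrbracket$ (block-parallel update modes of size $n$). For $\mu=\{S_k\}_{k\in\llbracket s\rrbracket}\in\mathsf{BP}_n$, let $p=\mathrm{lcm}(n_0,\dots,n_{s-1})$ and define the sequence of blocks $\varphi(\mu)=(W_\ell)_{\ell\in\llbracket p\rrbracket}$ by $W_\ell=\{i^k_{\ell \bmod n_k}\mid k\in\llbracket s\rrbracket\}$. For $\mu,\mu'\in\mathsf{BP}_n$, $\mu\equiv_0\mu'$ means $\varphi(\mu)=\varphi(\mu')$ (equality of sequences of sets). Automata networks: an automata network of size $n$ is a function $f:X\to X$ with $X=\prod_{i\in\llbracket n\rrbracket}X_i$, each $X_i$ being a finite alphabet; $f_i:X\to X_i$ is the $i$-th component of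 $f$. For $W\subseteq\llbracket n\rrbracket$, $f_{(W)}:X\to X$ is defined by $f_{(W)}(x)_i=f_i(x)$ if $i\in W$ and $f_{(W)}(x)_i=x_i$ otherwise. For $\mu\in\mathsf{BP}_n$ with $\varphi(\mu)=(W_0,\dots,W_{p-1})$, the update of $f$ under $\mu$ is $f_{\{\mu\}}=f_{(W_{p-1})}\circ\dots\circ f_{(W_1)}\circ f_{(W_0)}$. *)

theory Defs
  imports Main "HOL-Library.FuncSet" "HOL-Library.Infinite_Typeclass"
begin

definition partitioned_orders :: "nat \<Rightarrow> nat list set set" where
  "partitioned_orders n = {\<mu>.
     (\<forall>S\<in>\<mu>. S \<noteq> [] \<and> distinct S) \<and>
     (\<forall>S\<in>\<mu>. \<forall>T\<in>\<mu>. S \<noteq> T \<longrightarrow> set S \<inter> set T = {}) \<and>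
     (\<Union>S\<in>\<mu>. set S) = {..<n}}"

definition blocks :: "nat list set \<Rightarrow> nat set list" where
  "blocks \<mu> = map (\<lambda>l. {S ! (l mod length S) | S. S \<in> \<mu>}) [0..<Lcm (length ` \<mu>)]"

definition equiv0 :: "nat list set \<Rightarrow> nat list set \<Rightarrow> bool"  (infix "\<equiv>\<^sub>0" 50) where
  "\<mu> \<equiv>\<^sub>0 \<mu>' \<longleftrightarrow> blocks \<mu> = blocks \<mu>'"

text \<open>Alphabets are finite non-empty subsets \<open>X i\<close> of an ambient type of symbols;
  when that type is infinite, every family of finite alphabets occurs up to renaming. The
  product of the \<open>X i\<close> over \<open>i < n\<close> is a set of functions that are \<^const>\<open>undefined\<close> outside
  \<open>{..<n}\<close>, and an automata network is only meaningful on that set.\<close>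

definition configs :: "nat \<Rightarrow> (nat \<Rightarrow> 'a set) \<Rightarrow> (nat \<Rightarrow> 'a) set" where
  "configs n X = (\<Pi>\<^sub>E i\<in>{..<n}. X i)"

definition automata_network ::
    "nat \<Rightarrow> (nat \<Rightarrow> 'a set) \<Rightarrow> ((nat \<Rightarrow> 'a) \<Rightarrow> (nat \<Rightarrow> 'a)) \<Rightarrow> bool" where
  "automata_network n X f \<longleftrightarrow>
     (\<forall>i<n. finite (X i) \<and> X i \<noteq> {}) \<and> f \<in> configs n X \<rightarrow> configs n X"

definition block_update ::
    "((nat \<Rightarrow> 'a) \<Rightarrow> (nat \<Rightarrow> 'a)) \<Rightarrow> nat set \<Rightarrow> (nat \<Rightarrow> 'a) \<Rightarrow> (nat \<Rightarrow> 'a)" where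
  "block_update f W x = (\<lambda>i. if i \<in> W then f x i else x i)"

text \<open>\<^const>\<open>fold\<close> applies the head of the list first, as required: the first block is
  updated first.\<close>

definition update ::
    "((nat \<Rightarrow> 'a) \<Rightarrow> (nat \<Rightarrow> 'a)) \<Rightarrow> nat list set \<Rightarrow> (nat \<Rightarrow> 'a) \<Rightarrow> (nat \<Rightarrow> 'a)" where
  "update f \<mu> = fold (block_update f) (blocks \<mu>)"

end

theory Submission
  imports Defs "HOL-Library.Nat_Bijection"
begin

text \<open>Let every automaton keep a set of time stamps, and let an update of \<open>i\<close> add to the set of
  \<open>i\<close> the total number of stamps present in the network. This number is the total size of the
  blocks executed before, so it strictly increases along any sequence of non-empty blocks and all
  members of one block receive the same stamp. Started from empty sets, the final configuration
  therefore determines the whole sequence of blocks: the first block consists of the automata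
  carrying the smallest stamp, and so on. Truncating the stamps at a large \<open>N\<close> makes the
  alphabets finite.\<close>

fun stamps :: "nat \<Rightarrow> nat set list \<Rightarrow> nat \<Rightarrow> nat set" where
  "stamps k [] i = {}"
| "stamps k (W # Ws) i = (if i \<in> W then {k} else {}) \<union> stamps (k + card W) Ws i"

lemma stamps_ge: "m \<in> stamps k Ws i \<Longrightarrow> k \<le> m"
proof (induction Ws arbitrary: k)
  case (Cons W Ws)
  then show ?case by (fastforce split: if_splits dest: Cons.IH)
qed simp

text \<open>Blocks inside \<open>{..<n}\<close> are finite, so a non-empty one has positive
  cardinality and every stamp of the tail exceeds \<open>k\<close>. Hence the head block can be read
  off, its stamp removed, and the induction continued with the offset \<open>k + card W\<close>,
  which is the same on both sides.\<close>

lemma stamps_inject: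
  assumes "\<forall>W\<in>set Ws. W \<noteq> {} \<and> W \<subseteq> {..<n}" and "\<forall>W\<in>set Vs. W \<noteq> {} \<and> W \<subseteq> {..<n}"
    and "\<And>i. i < n \<Longrightarrow> stamps k Ws i = stamps k Vs i"
  shows "Ws = Vs"
  using assms
proof (induction Ws arbitrary: k Vs)
  case Nil
  show ?case
  proof (cases Vs)
    case (Cons V Us)
    then obtain i where "i \<in> V" "i < n" using Nil.prems(2) by fastforce
    then show ?thesis using Nil.prems(3)[of i] Cons by simp
  qed simp
next
  case (Cons W Ws)
  have W: "W \<noteq> {}" "W \<subseteq> {..<n}" using Cons.prems(1) by auto
  obtain V Us where Vs: "Vs = V # Us"
  proof (cases Vs)
    case Nil
    obtain i where "i \<in> W" "i < n" using W by fastforce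
    then show ?thesis using Cons.prems(3)[of i] Nil by simp
  qed
  have V: "V \<noteq> {}" "V \<subseteq> {..<n}" using Cons.prems(2) Vs by auto
  have head: "U = {i. i < n \<and> k \<in> stamps k (U # Us) i}" if "U \<noteq> {}" "U \<subseteq> {..<n}" for U Us
  proof -
    have "card U > 0" using that finite_subset by (auto simp: card_gt_0_iff)
    then have "k \<notin> stamps (k + card U) Us i" for i using stamps_ge by fastforce
    then show ?thesis using that by auto
  qed
  have WV: "W = V"
    using head[OF W, of Ws] head[OF V, of Us] Cons.prems(3) Vs by blast
  have "stamps (k + card W) Ws i = stamps (k + card W) Us i" if "i < n" for i
  proof -
    have "card W > 0" using W finite_subset by (auto simp: card_gt_0_iff)
    then have "k \<notin> stamps (k + card W) Qs i" for Qs using stamps_ge by fastforce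
    \<comment> \<open>As \<open>k\<close> lies in neither tail, it can be cancelled from both sides
      when \<open>i\<close> belongs to the common head block.\<close>
    then show ?thesis using Cons.prems(3)[OF that] Vs WV by (auto simp: insert_ident split: if_splits)
  qed
  then have "Ws = Us" using Cons.IH[of Us "k + card W"] Cons.prems Vs by auto
  then show ?case using WV Vs by simp
qed

text \<open>Symbols come from an arbitrary infinite type, so stamp sets are stored as codes
  \<open>enc A\<close> and read back by \<open>dec\<close>.\<close>

definition stamp_network ::
    "nat \<Rightarrow> nat \<Rightarrow> (nat set \<Rightarrow> 'a) \<Rightarrow> ('a \<Rightarrow> nat set) \<Rightarrow> (nat \<Rightarrow> 'a) \<Rightarrow> nat \<Rightarrow> 'a" where
  "stamp_network n N enc dec x =
     (\<lambda>i\<in>{..<n}. enc (insert (min N (\<Sum>j<n. card (dec (x j)))) (dec (x i))))"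

lemma automata_network_stamp_network:
  assumes dec_enc: "\<And>A. finite A \<Longrightarrow> dec (enc A) = A"
  shows "automata_network n (\<lambda>_. enc ` Pow {..N}) (stamp_network n N enc dec)"
proof -
  have "stamp_network n N enc dec x \<in> configs n (\<lambda>_. enc ` Pow {..N})"
    if x: "x \<in> configs n (\<lambda>_. enc ` Pow {..N})" for x
  proof -
    have "dec (x i) \<subseteq> {..N}" if i: "i < n" for i
    proof -
      have "x i \<in> enc ` Pow {..N}"
        using x i unfolding configs_def by (meson PiE_mem lessThan_iff)
      then obtain A where "A \<subseteq> {..N}" "x i = enc A" by blast
      then show ?thesis using dec_enc[of A] finite_subset[of A "{..N}"] by simp
    qed
    then show ?thesis
      unfolding configs_def stamp_network_def by (intro restrict_PiE_iff[THEN iffD2] ballI imageI) auto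
  qed
  then show ?thesis unfolding automata_network_def by auto
qed

text \<open>Invariant of the run: \<open>k\<close> stamps are present in total and all of them are
  below \<open>k\<close>, so the next stamp \<open>k\<close> is new to every automaton. The bound by
  \<open>N\<close> ensures that truncation never takes effect.\<close>

lemma dec_fold_stamp_network:
  assumes dec_enc: "\<And>A. finite A \<Longrightarrow> dec (enc A) = A"
    and "\<forall>W\<in>set Ws. W \<subseteq> {..<n}"
    and "k + sum_list (map card Ws) \<le> N"
    and "(\<Sum>j<n. card (dec (x j))) = k"
    and "\<And>i. i < n \<Longrightarrow> finite (dec (x i)) \<and> dec (x i) \<subseteq> {..<k}"
    and "\<forall>W\<in>set Ws. W \<noteq> {}"
    and "i < n"
  shows "dec (fold (block_update (stamp_network n N enc dec)) Ws x i) = dec (x i) \<union> stamps k Ws i"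
  using assms(2-)
proof (induction Ws arbitrary: k x)
  case (Cons W Ws)
  let ?y = "block_update (stamp_network n N enc dec) W x"
  have W: "W \<subseteq> {..<n}" "W \<noteq> {}" using Cons.prems by auto
  have "finite W" using W finite_subset by blast
  then have pos: "card W > 0" using W by (simp add: card_gt_0_iff)
  have y: "dec (?y j) = (if j \<in> W then {k} else {}) \<union> dec (x j)" if "j < n" for j
    using that Cons.prems(2,3) Cons.prems(4)[OF that]
    by (auto simp: block_update_def stamp_network_def dec_enc)
  have "card (dec (?y j)) = (if j \<in> W then 1 else 0) + card (dec (x j))" if "j < n" for j
  proof -
    \<comment> \<open>Freshness of \<open>k\<close> makes each updated set grow by exactly one, so
      the total grows by \<open>card W\<close>.\<close>
    have "k \<notin> dec (x j)" using Cons.prems(4)[OF that] by auto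
    then show ?thesis using y[OF that] Cons.prems(4)[OF that] by simp
  qed
  then have "(\<Sum>j<n. card (dec (?y j))) = (\<Sum>j<n. if j \<in> W then 1 else 0) + k"
    using Cons.prems(3) by (simp add: sum.distrib)
  also have "(\<Sum>j<n. if j \<in> W then 1 else 0) = card W"
    using W by (simp add: sum.If_cases Int_absorb1)
  finally have card_y: "(\<Sum>j<n. card (dec (?y j))) = k + card W" by simp
  \<comment> \<open>The new stamp \<open>k\<close> itself stays below the new total because
    \<open>W\<close> is non-empty.\<close>
  have bound_y: "finite (dec (?y j)) \<and> dec (?y j) \<subseteq> {..<k + card W}" if "j < n" for j
    using Cons.prems(4)[OF that] y[OF that] pos by force
  have "dec (fold (block_update (stamp_network n N enc dec)) Ws ?y i)
      = dec (?y i) \<union> stamps (k + card W) Ws i"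
    using Cons.prems by (intro Cons.IH card_y bound_y) (auto simp: add.assoc)
  then show ?case using y[OF \<open>i < n\<close>] by auto
qed simp

lemma blocks_partitioned_orders:
  assumes "n \<ge> 1" and \<mu>: "\<mu> \<in> partitioned_orders n"
  shows "\<forall>W\<in>set (blocks \<mu>). W \<noteq> {} \<and> W \<subseteq> {..<n}"
proof
  fix W assume "W \<in> set (blocks \<mu>)"
  then obtain l where W: "W = {S ! (l mod length S) | S. S \<in> \<mu>}"
    unfolding blocks_def by auto
  have ne: "S \<noteq> []" if "S \<in> \<mu>" for S using that \<mu> unfolding partitioned_orders_def by auto
  have union: "(\<Union>S\<in>\<mu>. set S) = {..<n}" using \<mu> unfolding partitioned_orders_def by auto
  \<comment> \<open>This is where \<open>n \<ge> 1\<close> enters: for \<open>n = 0\<close> the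
    empty order has a single, empty block.\<close>
  have "0 \<in> (\<Union>S\<in>\<mu>. set S)" using union \<open>n \<ge> 1\<close> by simp
  then have "\<mu> \<noteq> {}" by auto
  moreover have "S ! (l mod length S) < n" if "S \<in> \<mu>" for S
  proof -
    have "S ! (l mod length S) \<in> set S" using ne[OF that] by simp
    then show ?thesis using union that by blast
  qed
  ultimately show "W \<noteq> {} \<and> W \<subseteq> {..<n}" unfolding W by auto
qed

text \<open>An infinite type contains a copy of the naturals, and \<open>set_encode\<close> codes
  finite sets of naturals in binary.\<close>

lemma ex_finite_set_encoding:
  "\<exists>(enc :: nat set \<Rightarrow> 'a::infinite) dec. \<forall>A. finite A \<longrightarrow> dec (enc A) = A"
proof -
  obtain h :: "nat \<Rightarrow> 'a" where "inj h"
    using infinite_countable_subset[OF infinite_UNIV] by blast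
  then have "set_decode (inv h (h (set_encode A))) = A" if "finite A" for A
    using that by simp
  then show ?thesis
    by (intro exI[of _ "h \<circ> set_encode"] exI[of _ "set_decode \<circ> inv h"]) simp
qed

theorem lemma2:
  fixes n :: nat and \<mu> \<mu>' :: "nat list set"
  assumes "n \<ge> 1"
    and "\<mu> \<in> partitioned_orders n"
    and "\<mu>' \<in> partitioned_orders n"
  shows "\<mu> \<equiv>\<^sub>0 \<mu>' \<longleftrightarrow>
    (\<forall>(X :: nat \<Rightarrow> 'a::infinite set) f. automata_network n X f \<longrightarrow>
       (\<forall>x\<in>configs n X. update f \<mu> x = update f \<mu>' x))"
proof
  assume "\<mu> \<equiv>\<^sub>0 \<mu>'"
  then show "\<forall>(X :: nat \<Rightarrow> 'a set) f. automata_network n X f \<longrightarrow>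
       (\<forall>x\<in>configs n X. update f \<mu> x = update f \<mu>' x)"
    by (simp add: equiv0_def update_def)
next
  assume same: "\<forall>(X :: nat \<Rightarrow> 'a set) f. automata_network n X f \<longrightarrow>
       (\<forall>x\<in>configs n X. update f \<mu> x = update f \<mu>' x)"
  obtain enc :: "nat set \<Rightarrow> 'a" and dec where dec_enc: "\<And>A. finite A \<Longrightarrow> dec (enc A) = A"
    using ex_finite_set_encoding by blast
  note bl = blocks_partitioned_orders[OF assms(1,2)] blocks_partitioned_orders[OF assms(1,3)]
  \<comment> \<open>Adding both totals gives one bound, hence one network, that serves both update
    modes.\<close>
  define N where "N = sum_list (map card (blocks \<mu>)) + sum_list (map card (blocks \<mu>'))"
  define f where "f = stamp_network n N enc dec"
  \<comment> \<open>With no stamps present, the invariant of the run holds initially for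
    \<open>k = 0\<close>.\<close>
  define x where "x = (\<lambda>i\<in>{..<n}. enc {})"
  have "x \<in> configs n (\<lambda>_. enc ` Pow {..N})" unfolding x_def configs_def by auto
  then have eq: "update f \<mu> x = update f \<mu>' x"
    using same automata_network_stamp_network[of dec enc n N] dec_enc unfolding f_def by blast
  have x: "dec (x i) = {}" if "i < n" for i using that dec_enc by (simp add: x_def)
  have run: "dec (fold (block_update f) Ws x i) = stamps 0 Ws i"
    if "\<forall>W\<in>set Ws. W \<noteq> {} \<and> W \<subseteq> {..<n}" "sum_list (map card Ws) \<le> N" "i < n" for Ws i
    using dec_fold_stamp_network[of dec enc Ws n 0 N x i] that x dec_enc by (simp add: f_def)
  have "stamps 0 (blocks \<mu>) i = stamps 0 (blocks \<mu>') i" if "i < n" for i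
    using run[OF bl(1) _ that] run[OF bl(2) _ that] eq by (simp add: N_def update_def)
  then show "\<mu> \<equiv>\<^sub>0 \<mu>'" unfolding equiv0_def using stamps_inject[OF bl] by blast
qed

end
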